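(* Let $R$ be a finite commutative Frobenius ring with generating character $\varepsilon:(R,+)\to\mathbb{C}^\times$, let $V=R^k$ with a perfect $R$-bilinear form $\beta:V\times V\to R$, let $n\ge 1$, and let $S$ be a stabiliser subgroup of the Weyl group acting on $\mathrm{Fun}(V^{\oplus n},\mathbb{C})$. If $S$ contains an element $W(a,b)$, with $a,b\in V^{\oplus n}$, such that $\varepsilon(\beta(b,a))\neq 1$, then $S$ does not admit a CSS generating set (i.e. $S$ is not CSS).
   Context: A finite commutative ring $R$ is Frobenius with generating character $\varepsilon$ if $\varepsilon:(R,+)\to\mathbb{C}^\times$ is a character such that $x\mapsto(y\mapsto\varepsilon(xy))$ is an isomorphism $R\to\widehat R$ of $R$-modules, where $\widehat R$ is the group of additive characters of $R$. A bilinear form $\beta:V\times V\to R$ is perfect if the induced maps $V\to\mathrm{Hom}_R(V,R)$ are isomorphisms. The form $\beta$ is extended to $V^{\oplus n}$ by $\beta(x,y)=\sum_{i=1}^n\beta(x_i,y_i)$. For $a,b\in V^{\oplus n}$, operators on the space $\mathrm{Fun}(V^{\oplus n},\mathbb{C})$ of functions $V^{\oplus n}\to\mathbb{C}$: $(T_af)(x)=f(x-a)$, $(M_bf)(x)=\varepsilon(\beta(b,x))f(x)$, $W(a,b)=T_aM_b$. The Weyl group is the group generated by all $W(a,b)$. A stabiliser subgroup is an abelian subgroup of the Weyl group generated by operators $W(a,b)$. A stabiliser subgroup $S$ is CSS (admits a CSS generating set) if there exist $R$-submodules $A,B\subseteq V^{\oplus n}$ such that $S=\langle T_a:a\in A\rangle\cdot\langle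 M_b:b\in B\rangle$ and all these generators commute. *)

theory Defs
  imports
    "HOL-Analysis.Finite_Cartesian_Product"
    "HOL-Algebra.Bij"
    "HOL-Algebra.Generated_Groups"
begin

definition add_character :: "('r::comm_ring_1 \<Rightarrow> complex) \<Rightarrow> bool" where
  "add_character \<psi> \<longleftrightarrow> (\<forall>x. \<psi> x \<noteq> 0) \<and> (\<forall>x y. \<psi> (x + y) = \<psi> x * \<psi> y)"

text \<open>
  The group operation on characters is the pointwise product, and a ring element \<open>r\<close> acts on a
  character \<open>\<psi>\<close> by \<open>(r \<cdot> \<psi>) y = \<psi> (r * y)\<close>. The last three conjuncts below say that
  \<open>x \<mapsto> (y \<mapsto> \<epsilon> (x * y))\<close> is an isomorphism of modules from the ring onto its character group.
\<close>

definition generating_character :: "('r::{comm_ring_1,finite} \<Rightarrow> complex) \<Rightarrow> bool" where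
  "generating_character \<epsilon> \<longleftrightarrow> add_character \<epsilon> \<and>
     (let \<Phi> = (\<lambda>x y. \<epsilon> (x * y)) in
        bij_betw \<Phi> UNIV {\<psi>. add_character \<psi>} \<and>
        (\<forall>x x'. \<Phi> (x + x') = (\<lambda>y. \<Phi> x y * \<Phi> x' y)) \<and>
        (\<forall>r x. \<Phi> (r * x) = (\<lambda>y. \<Phi> x (r * y))))"

definition bilinear_form :: "('r::comm_ring_1^'k \<Rightarrow> 'r^'k \<Rightarrow> 'r) \<Rightarrow> bool" where
  "bilinear_form \<beta> \<longleftrightarrow>
     (\<forall>x. module_hom (*s) (*) (\<lambda>y. \<beta> x y)) \<and> (\<forall>y. module_hom (*s) (*) (\<lambda>x. \<beta> x y))"

text \<open>
  The two induced maps into the dual module are linear by bilinearity of the form, so they are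
  isomorphisms iff they are bijective.
\<close>

definition perfect_form :: "('r::comm_ring_1^'k \<Rightarrow> 'r^'k \<Rightarrow> 'r) \<Rightarrow> bool" where
  "perfect_form \<beta> \<longleftrightarrow> bilinear_form \<beta> \<and>
     bij_betw (\<lambda>x y. \<beta> x y) UNIV {f. module_hom (*s) (*) f} \<and>
     bij_betw (\<lambda>y x. \<beta> x y) UNIV {f. module_hom (*s) (*) f}"

definition ext_form ::
    "('r::comm_ring_1^'k \<Rightarrow> 'r^'k \<Rightarrow> 'r) \<Rightarrow> 'r^'k^'n \<Rightarrow> 'r^'k^'n \<Rightarrow> 'r" where
  "ext_form \<beta> x y = (\<Sum>i\<in>UNIV. \<beta> (x $ i) (y $ i))"

type_synonym ('r, 'k, 'n) operator = "('r^'k^'n \<Rightarrow> complex) \<Rightarrow> ('r^'k^'n \<Rightarrow> complex)"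

definition translation_op :: "'r::comm_ring_1^'k^'n \<Rightarrow> ('r, 'k, 'n::finite) operator" where
  "translation_op a f = (\<lambda>x. f (x - a))"

definition modulation_op ::
    "('r::comm_ring_1 \<Rightarrow> complex) \<Rightarrow> ('r^'k \<Rightarrow> 'r^'k \<Rightarrow> 'r) \<Rightarrow> 'r^'k^'n \<Rightarrow> ('r, 'k, 'n::finite) operator" where
  "modulation_op \<epsilon> \<beta> b f = (\<lambda>x. \<epsilon> (ext_form \<beta> b x) * f x)"

definition weyl_op ::
    "('r::comm_ring_1 \<Rightarrow> complex) \<Rightarrow> ('r^'k \<Rightarrow> 'r^'k \<Rightarrow> 'r) \<Rightarrow> 'r^'k^'n \<Rightarrow> 'r^'k^'n \<Rightarrow>
      ('r, 'k, 'n::finite) operator" where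
  "weyl_op \<epsilon> \<beta> a b = translation_op a \<circ> modulation_op \<epsilon> \<beta> b"

text \<open>
  The ambient group of invertible operators is \<open>BijGroup UNIV\<close>, whose multiplication is composition
  (see \<open>mult_BijGroup_UNIV\<close>) and which contains all Weyl operators (see \<open>weyl_op_Bij\<close>).
\<close>

definition weyl_group ::
    "('r::comm_ring_1 \<Rightarrow> complex) \<Rightarrow> ('r^'k \<Rightarrow> 'r^'k \<Rightarrow> 'r) \<Rightarrow> ('r, 'k, 'n::finite) operator monoid" where
  "weyl_group \<epsilon> \<beta> =
     (BijGroup UNIV)\<lparr>carrier := generate (BijGroup UNIV) {weyl_op \<epsilon> \<beta> a b |a b. True}\<rparr>"

definition stabiliser_subgroup ::
    "('r::comm_ring_1 \<Rightarrow> complex) \<Rightarrow> ('r^'k \<Rightarrow> 'r^'k \<Rightarrow> 'r) \<Rightarrow> ('r, 'k, 'n::finite) operator set \<Rightarrow> bool" where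
  "stabiliser_subgroup \<epsilon> \<beta> S \<longleftrightarrow>
     subgroup S (weyl_group \<epsilon> \<beta>) \<and>
     comm_group ((weyl_group \<epsilon> \<beta>)\<lparr>carrier := S\<rparr>) \<and>
     (\<exists>G \<subseteq> {weyl_op \<epsilon> \<beta> a b |a b. True}. S = generate (weyl_group \<epsilon> \<beta>) G)"

definition scale_power :: "'r::comm_ring_1 \<Rightarrow> 'r^'k^'n \<Rightarrow> 'r^'k^'n" where
  "scale_power r x = (\<chi> i. r *s (x $ i))"

definition css ::
    "('r::comm_ring_1 \<Rightarrow> complex) \<Rightarrow> ('r^'k \<Rightarrow> 'r^'k \<Rightarrow> 'r) \<Rightarrow> ('r, 'k, 'n::finite) operator set \<Rightarrow> bool" where
  "css \<epsilon> \<beta> S \<longleftrightarrow>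
     (\<exists>A B. module.subspace scale_power A \<and> module.subspace scale_power B \<and>
        S = generate (weyl_group \<epsilon> \<beta>) (translation_op ` A)
              <#>\<^bsub>weyl_group \<epsilon> \<beta>\<^esub> generate (weyl_group \<epsilon> \<beta>) (modulation_op \<epsilon> \<beta> ` B) \<and>
        (\<forall>g \<in> translation_op ` A \<union> modulation_op \<epsilon> \<beta> ` B.
         \<forall>h \<in> translation_op ` A \<union> modulation_op \<epsilon> \<beta> ` B. g \<circ> h = h \<circ> g))"

lemma module_vec: "module ((*s) :: 'r::comm_ring_1 \<Rightarrow> 'r^'k \<Rightarrow> 'r^'k)"
  by unfold_locales (simp_all add: vec_eq_iff algebra_simps)

lemma module_ring: "module ((*) :: 'r::comm_ring_1 \<Rightarrow> 'r \<Rightarrow> 'r)"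
  by unfold_locales (simp_all add: algebra_simps)

lemma module_scale_power: "module (scale_power :: 'r::comm_ring_1 \<Rightarrow> 'r^'k^'n \<Rightarrow> 'r^'k^'n)"
  by unfold_locales (simp_all add: scale_power_def vec_eq_iff algebra_simps)

lemma mult_BijGroup_UNIV:
  assumes "bij f" "bij g"
  shows "f \<otimes>\<^bsub>BijGroup UNIV\<^esub> g = f \<circ> g"
  using assms by (auto simp: BijGroup_def Bij_def compose_def fun_eq_iff)

lemma weyl_op_Bij:
  assumes "add_character \<epsilon>"
  shows "weyl_op \<epsilon> \<beta> a b \<in> carrier (BijGroup UNIV)"
proof -
  have "bij (translation_op a)"
    by (rule bij_betw_byWitness[where f' = "translation_op (- a)"])
       (auto simp: translation_op_def)
  moreover have "bij (modulation_op \<epsilon> \<beta> b)"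
    by (rule bij_betw_byWitness[where f' = "\<lambda>f x. f x / \<epsilon> (ext_form \<beta> b x)"])
       (use assms in \<open>auto simp: modulation_op_def add_character_def\<close>)
  ultimately show ?thesis
    by (auto simp: weyl_op_def BijGroup_def Bij_def intro: bij_comp)
qed

end

theory Submission
  imports Defs
begin

text \<open>
  Since \<open>a \<mapsto> T\<^sub>a\<close> and \<open>b \<mapsto> M\<^sub>b\<close> are homomorphisms, every element of a CSS group
  is \<open>T\<^sub>c M\<^sub>d\<close> with \<open>c \<in> A\<close> and \<open>d \<in> B\<close>, and the commutation of the two factors forces
  \<open>\<epsilon> (\<beta>(d, c)) = 1\<close>. A Weyl operator \<open>W(a, b)\<close> determines \<open>a\<close> and the character
  \<open>\<epsilon> (\<beta>(b, -))\<close>, so \<open>W(a, b) = T\<^sub>c M\<^sub>d\<close> gives \<open>\<epsilon> (\<beta>(b, a)) = 1\<close>.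
\<close>

text \<open>The homomorphic image of an additive subgroup is already a subgroup, so generating adds
  nothing. This is what reduces each factor of a CSS group to single operators.\<close>

lemma (in group) generate_additive_image:
  fixes h :: "'x::group_add \<Rightarrow> 'a"
  assumes closed: "\<And>x. h x \<in> carrier G"
    and hom: "\<And>x y. h (x + y) = h x \<otimes> h y"
    and A: "0 \<in> A" "\<And>x y. x \<in> A \<Longrightarrow> y \<in> A \<Longrightarrow> x + y \<in> A" "\<And>x. x \<in> A \<Longrightarrow> - x \<in> A"
  shows "generate G (h ` A) = h ` A"
proof -
  have one: "h 0 = \<one>"
    using hom[of 0 0] closed[of 0] by simp
  have inv: "inv (h x) = h (- x)" for x
    by (rule inv_equality) (simp_all add: closed one flip: hom)
  have "subgroup (h ` A) G"
    by (rule subgroupI) (use A closed in \<open>auto simp: inv simp flip: hom\<close>)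
  then show ?thesis
    by (meson generate_subgroup_incl generate.incl subset_antisym subset_refl subsetI)
qed

lemma add_character_0:
  assumes "add_character \<psi>"
  shows "\<psi> 0 = 1"
proof -
  have "\<psi> 0 * \<psi> 0 = \<psi> 0" "\<psi> 0 \<noteq> 0"
    using assms unfolding add_character_def by (metis add_0_left, blast)
  then show ?thesis by simp
qed

lemma ext_form_add_left:
  assumes "bilinear_form \<beta>"
  shows "ext_form \<beta> (x + y) z = ext_form \<beta> x z + ext_form \<beta> y z"
proof -
  have "\<beta> (u + v) w = \<beta> u w + \<beta> v w" for u v w
    using assms module_hom.add unfolding bilinear_form_def by blast
  then show ?thesis
    by (simp add: ext_form_def sum.distrib)
qed

lemma ext_form_add_right:
  assumes "bilinear_form \<beta>"
  shows "ext_form \<beta> x (y + z) = ext_form \<beta> x y + ext_form \<beta> x z"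
proof -
  have "\<beta> u (v + w) = \<beta> u v + \<beta> u w" for u v w
    using assms module_hom.add unfolding bilinear_form_def by blast
  then show ?thesis
    by (simp add: ext_form_def sum.distrib)
qed

lemma ext_form_0_left:
  assumes "bilinear_form \<beta>"
  shows "ext_form \<beta> 0 x = 0"
  using ext_form_add_left[OF assms, of 0 0 x] by simp

lemma translation_op_add: "translation_op (a + b) = translation_op a \<circ> translation_op b"
  by (simp add: translation_op_def fun_eq_iff diff_diff_eq)

lemma modulation_op_add:
  assumes "add_character \<epsilon>" "bilinear_form \<beta>"
  shows "modulation_op \<epsilon> \<beta> (a + b) = modulation_op \<epsilon> \<beta> a \<circ> modulation_op \<epsilon> \<beta> b"
  using assms by (simp add: modulation_op_def add_character_def ext_form_add_left fun_eq_iff)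

text \<open>Together with \<open>weyl_op_0_left\<close> this puts translations and modulations among
  the Weyl generators, hence in the carrier of the Weyl group.\<close>

lemma weyl_op_0_right:
  assumes "add_character \<epsilon>" "bilinear_form \<beta>"
  shows "weyl_op \<epsilon> \<beta> a 0 = translation_op a"
  using assms
  by (simp add: weyl_op_def modulation_op_def ext_form_0_left add_character_0 fun_eq_iff)

lemma weyl_op_0_left: "weyl_op \<epsilon> \<beta> 0 b = modulation_op \<epsilon> \<beta> b"
  by (simp add: weyl_op_def translation_op_def fun_eq_iff)

lemma weyl_op_in_weyl_group: "weyl_op \<epsilon> \<beta> a b \<in> carrier (weyl_group \<epsilon> \<beta>)"
  by (auto simp: weyl_group_def intro: generate.incl)

lemma weyl_generators_subset:
  assumes "add_character \<epsilon>"
  shows "{weyl_op \<epsilon> \<beta> a b |a b. True} \<subseteq> carrier (BijGroup UNIV)"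
  using weyl_op_Bij[OF assms] by blast

lemma group_weyl_group:
  assumes "add_character \<epsilon>"
  shows "group (weyl_group \<epsilon> \<beta>)"
  unfolding weyl_group_def
  using group.subgroup_imp_group group.generate_is_subgroup group_BijGroup
    weyl_generators_subset[OF assms] by blast

text \<open>The product of \<open>BijGroup UNIV\<close> is ordinary composition only on bijections.
  Membership in the carrier supplies bijectivity, since the Weyl operators generate inside
  \<open>BijGroup UNIV\<close>.\<close>

lemma mult_weyl_group:
  assumes "add_character \<epsilon>"
    and "f \<in> carrier (weyl_group \<epsilon> \<beta>)" "g \<in> carrier (weyl_group \<epsilon> \<beta>)"
  shows "f \<otimes>\<^bsub>weyl_group \<epsilon> \<beta>\<^esub> g = f \<circ> g"
proof -
  have "carrier (weyl_group \<epsilon> \<beta>) \<subseteq> carrier (BijGroup UNIV)"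
    using group.generate_incl[OF group_BijGroup weyl_generators_subset[OF assms(1)]]
    by (simp add: weyl_group_def)
  then have "bij f" "bij g"
    using assms(2,3) by (auto simp: BijGroup_def Bij_def)
  then show ?thesis
    by (simp add: weyl_group_def mult_BijGroup_UNIV)
qed

lemma generate_subspace_image:
  assumes "add_character \<epsilon>" "module.subspace scale_power A"
    and "\<And>x. h x \<in> carrier (weyl_group \<epsilon> \<beta>)" "\<And>x y. h (x + y) = h x \<circ> h y"
  shows "generate (weyl_group \<epsilon> \<beta>) (h ` A) = h ` A"
  by (rule group.generate_additive_image[OF group_weyl_group])
     (simp_all add: assms mult_weyl_group module.subspace_0[OF module_scale_power]
       module.subspace_add[OF module_scale_power] module.subspace_neg[OF module_scale_power])

text \<open>Both generated factors collapse to the images of \<open>A\<close> and \<open>B\<close>,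
  so an element of their set product is one translation times one modulation. Of the submodules only
  the commutation of this pair is kept.\<close>

lemma css_weyl_form:
  assumes \<epsilon>: "add_character \<epsilon>" and \<beta>: "bilinear_form \<beta>"
    and "css \<epsilon> \<beta> S" "g \<in> S"
  obtains c d where "g = weyl_op \<epsilon> \<beta> c d"
    "translation_op c \<circ> modulation_op \<epsilon> \<beta> d = modulation_op \<epsilon> \<beta> d \<circ> translation_op c"
proof -
  let ?W = "weyl_group \<epsilon> \<beta>"
  obtain A B where AB: "module.subspace scale_power A" "module.subspace scale_power B"
    and S: "S = generate ?W (translation_op ` A) <#>\<^bsub>?W\<^esub> generate ?W (modulation_op \<epsilon> \<beta> ` B)"
    and comm: "\<forall>g \<in> translation_op ` A \<union> modulation_op \<epsilon> \<beta> ` B.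
         \<forall>h \<in> translation_op ` A \<union> modulation_op \<epsilon> \<beta> ` B. g \<circ> h = h \<circ> g"
    using assms(3) unfolding css_def by blast
  have T: "translation_op x \<in> carrier ?W" for x
    using weyl_op_in_weyl_group weyl_op_0_right[OF \<epsilon> \<beta>] by metis
  have M: "modulation_op \<epsilon> \<beta> x \<in> carrier ?W" for x
    using weyl_op_in_weyl_group weyl_op_0_left by metis
  have "S = translation_op ` A <#>\<^bsub>?W\<^esub> modulation_op \<epsilon> \<beta> ` B"
    using generate_subspace_image[where h = translation_op, OF \<epsilon> AB(1) T translation_op_add]
      generate_subspace_image[where h = "modulation_op \<epsilon> \<beta>", OF \<epsilon> AB(2) M modulation_op_add[OF \<epsilon> \<beta>]]
    by (simp add: S)
  then obtain c d where "c \<in> A" "d \<in> B" "g = translation_op c \<otimes>\<^bsub>?W\<^esub> modulation_op \<epsilon> \<beta> d"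
    using assms(4) by (auto simp: set_mult_def)
  moreover have "translation_op c \<circ> modulation_op \<epsilon> \<beta> d = modulation_op \<epsilon> \<beta> d \<circ> translation_op c"
    using comm \<open>c \<in> A\<close> \<open>d \<in> B\<close> by blast
  ultimately show thesis
    using that[of c d] mult_weyl_group[OF \<epsilon> T M, of c d] by (metis weyl_op_def)
qed

lemma commuting_imp_character_trivial:
  assumes \<epsilon>: "add_character \<epsilon>" and \<beta>: "bilinear_form \<beta>"
    and "translation_op c \<circ> modulation_op \<epsilon> \<beta> d = modulation_op \<epsilon> \<beta> d \<circ> translation_op c"
  shows "\<epsilon> (ext_form \<beta> d c) = 1"
proof -
  \<comment> \<open>Testing on the constant function 1 at the point \<open>c\<close>: the left side
    modulates before shifting and so reads the character at \<open>c - c = 0\<close>, the right side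
    reads it at \<open>c\<close>.\<close>
  have "(translation_op c \<circ> modulation_op \<epsilon> \<beta> d) (\<lambda>_. 1) c
      = (modulation_op \<epsilon> \<beta> d \<circ> translation_op c) (\<lambda>_. 1) c"
    by (simp only: assms(3))
  then have "\<epsilon> (ext_form \<beta> d 0) = \<epsilon> (ext_form \<beta> d c)"
    by (simp add: translation_op_def modulation_op_def)
  moreover have "ext_form \<beta> d 0 = 0"
    using ext_form_add_right[OF \<beta>, of d 0 0] by simp
  ultimately show ?thesis
    using add_character_0[OF \<epsilon>] by simp
qed

lemma weyl_op_eqD:
  assumes \<epsilon>: "add_character \<epsilon>" and eq: "weyl_op \<epsilon> \<beta> a b = weyl_op \<epsilon> \<beta> c d"
  shows "a = c" "\<epsilon> (ext_form \<beta> b x) = \<epsilon> (ext_form \<beta> d x)"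
proof -
  have ev: "\<epsilon> (ext_form \<beta> b (y - a)) * f (y - a) = \<epsilon> (ext_form \<beta> d (y - c)) * f (y - c)" for f y
    using fun_cong[OF fun_cong[OF eq, of f], of y]
    by (simp add: weyl_op_def translation_op_def modulation_op_def)
  \<comment> \<open>For the indicator of 0 at \<open>y = a\<close> the left side of
    \<open>ev\<close> is a nonzero character value, while the right side vanishes unless
    \<open>a - c = 0\<close>.\<close>
  show "a = c"
    using ev[of a "\<lambda>z. if z = 0 then 1 else 0"] \<epsilon>
    by (auto simp: add_character_def split: if_splits)
  \<comment> \<open>Once the shifts agree, the constant function 1 at \<open>x + a\<close> isolates
    the two character values at \<open>x\<close>.\<close>
  then show "\<epsilon> (ext_form \<beta> b x) = \<epsilon> (ext_form \<beta> d x)"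
    using ev[of "x + a" "\<lambda>_. 1"] by simp
qed

theorem proposition5p4:
  fixes \<epsilon> :: "'r::{comm_ring_1,finite} \<Rightarrow> complex"
    and \<beta> :: "'r^'k \<Rightarrow> 'r^'k \<Rightarrow> 'r"
    and S :: "('r, 'k, 'n::finite) operator set"
    and a b :: "'r^'k^'n"
  assumes "generating_character \<epsilon>"
    and "perfect_form \<beta>"
    and "stabiliser_subgroup \<epsilon> \<beta> S"
    and "weyl_op \<epsilon> \<beta> a b \<in> S"
    and "\<epsilon> (ext_form \<beta> b a) \<noteq> 1"
  shows "\<not> css \<epsilon> \<beta> S"
proof
  assume css: "css \<epsilon> \<beta> S"
  have \<epsilon>: "add_character \<epsilon>" and \<beta>: "bilinear_form \<beta>"
    using assms(1,2) by (auto simp: generating_character_def perfect_form_def)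
  obtain c d where eq: "weyl_op \<epsilon> \<beta> a b = weyl_op \<epsilon> \<beta> c d"
    and comm: "translation_op c \<circ> modulation_op \<epsilon> \<beta> d = modulation_op \<epsilon> \<beta> d \<circ> translation_op c"
    using css_weyl_form[OF \<epsilon> \<beta> css assms(4)] by metis
  \<comment> \<open>The characters of \<open>b\<close> and \<open>d\<close> are compared at the
    point \<open>a\<close>, which equals \<open>c\<close>.\<close>
  have "\<epsilon> (ext_form \<beta> b a) = \<epsilon> (ext_form \<beta> d c)"
    using weyl_op_eqD[OF \<epsilon> eq] by simp
  then show False
    using commuting_imp_character_trivial[OF \<epsilon> \<beta> comm] assms(5) by simp
qed

end
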